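(* Let $R$ be a commutative ring with identity containing $\mathbb{Q}$, let $N\ge2$, and let $X=(X_1,\ldots,X_N)$ and $t=(t_1,\ldots,t_N)$ be $N$-tuples of indeterminates ($2N$ algebraically independent indeterminates over $R$). Suppose $p(Y)\in R[Y_1,\ldots,Y_N]$, where $Y=(Y_1,\ldots,Y_N)$, satisfies the mean-value property $$\lambda_0\bigl(p(X+t)\bigr)=p(t)$$ in $R[t_1,\ldots,t_N]$, where $p(X+t)=p(X_1+t_1,\ldots,X_N+t_N)$ is viewed as a polynomial in $X_1,\ldots,X_N$ with coefficients in $R[t_1,\ldots,t_N]$. Then $p(X)$ is harmonic.
   Context: $p(X)$ is harmonic if $\Delta p=0$, where $\Delta=\partial_1^2+\cdots+\partial_N^2$, $\partial_j=\partial/\partial X_j$. For a commutative ring $S\supseteq\mathbb{Q}$, the normalized spherical mean $\lambda_0\colon S[X_1,\ldots,X_N]\to S$ is the unique $S$-linear map such that $\lambda_0\circ M_{jk}=0$ for all distinct $j,k\in\{1,\ldots,N\}$, where $M_{jk}=X_j\partial_k-X_k\partial_j$, and $\lambda_0\bigl((X_1^2+\cdots+X_N^2)^n\bigr)=1$ for all integers $n\ge0$ (it exists and is unique). Here it is used with $S=R[t_1,\ldots,t_N]$. *)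

theory Defs
  imports Complex_Main "HOL-Library.Cardinality" "HOL-Library.Poly_Mapping"
begin

text \<open>Polynomials over \<open>'a\<close> in indeterminates indexed by \<open>'n\<close>, as finitely supported functions
  from monomials (exponent vectors) to coefficients. The index type is meant to be finite, with
  \<open>CARD('n)\<close> playing the role of \<open>N\<close>. Only the positions of indeterminates are recorded, not their
  names: \<open>R[X]\<close>, \<open>R[Y]\<close> and \<open>R[t]\<close> are all \<open>('n, 'r) mpoly\<close>, and \<open>R[t][X]\<close> is
  \<open>('n, ('n, 'r) mpoly) mpoly\<close>.\<close>

type_synonym ('n, 'a) mpoly = "('n \<Rightarrow>\<^sub>0 nat) \<Rightarrow>\<^sub>0 'a"

definition Const :: "'a::zero \<Rightarrow> ('n, 'a) mpoly" where
  "Const c = Poly_Mapping.single 0 c"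

definition Var :: "'n \<Rightarrow> ('n, 'a::zero_neq_one) mpoly" where
  "Var i = Poly_Mapping.single (Poly_Mapping.single i 1) 1"

text \<open>Evaluation at \<open>f\<close>, with the coefficients mapped along \<open>h\<close>.\<close>

definition eval_mpoly ::
  "('a::zero \<Rightarrow> 'b::comm_semiring_1) \<Rightarrow> ('n::finite \<Rightarrow> 'b) \<Rightarrow> ('n, 'a) mpoly \<Rightarrow> 'b" where
  "eval_mpoly h f p =
     (\<Sum>m\<in>Poly_Mapping.keys p. h (Poly_Mapping.lookup p m) * (\<Prod>i\<in>UNIV. f i ^ Poly_Mapping.lookup m i))"

text \<open>The truncated subtraction of exponents is harmless: if \<open>i\<close> does not occur in \<open>m\<close>, then the
  coefficient of that summand is \<open>0\<close>.\<close>

definition pd :: "'n \<Rightarrow> ('n, 'a::comm_semiring_1) mpoly \<Rightarrow> ('n, 'a) mpoly" where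
  "pd i p = (\<Sum>m\<in>Poly_Mapping.keys p.
     Poly_Mapping.single (m - Poly_Mapping.single i 1)
       (of_nat (Poly_Mapping.lookup m i) * Poly_Mapping.lookup p m))"

definition laplacian :: "('n::finite, 'a::comm_semiring_1) mpoly \<Rightarrow> ('n, 'a) mpoly" where
  "laplacian p = (\<Sum>i\<in>UNIV. pd i (pd i p))"

definition harmonic :: "('n::finite, 'a::comm_semiring_1) mpoly \<Rightarrow> bool" where
  "harmonic p \<longleftrightarrow> laplacian p = 0"

definition rot :: "'n \<Rightarrow> 'n \<Rightarrow> ('n, 'a::comm_ring_1) mpoly \<Rightarrow> ('n, 'a) mpoly" where
  "rot j k p = Var j * pd k p - Var k * pd j p"

definition is_spherical_mean :: "(('n::finite, 's::comm_ring_1) mpoly \<Rightarrow> 's) \<Rightarrow> bool" where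
  "is_spherical_mean L \<longleftrightarrow>
     module_hom (\<lambda>c p. Const c * p) (*) L \<and>
     (\<forall>j k. j \<noteq> k \<longrightarrow> (\<forall>p. L (rot j k p) = 0)) \<and>
     (\<forall>n. L ((\<Sum>i\<in>UNIV. Var i ^ 2) ^ n) = 1)"

text \<open>Meaningful when there is exactly one such map, which is the case when \<open>CARD('n) \<ge> 2\<close> and
  the coefficient ring \<open>'s\<close> contains the rationals.\<close>

definition spherical_mean :: "('n::finite, 's::comm_ring_1) mpoly \<Rightarrow> 's" where
  "spherical_mean = (THE L. is_spherical_mean L)"

text \<open>The polynomial \<open>p(X + t)\<close> in \<open>R[t][X]\<close>: on the right, the outer \<open>Var i\<close> is \<open>X\<^sub>i\<close> and
  \<open>Const (Var i)\<close> is \<open>t\<^sub>i\<close>.\<close>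

definition translate :: "('n::finite, 'r::comm_ring_1) mpoly \<Rightarrow> ('n, ('n, 'r) mpoly) mpoly" where
  "translate p = eval_mpoly (\<lambda>c. Const (Const c)) (\<lambda>i. Var i + Const (Var i)) p"

end

theory Submission
  imports Defs
begin

text \<open>
  The spherical mean is given by Pizzetti's formula: \<open>\<lambda>\<^sub>0(p)\<close> is the sum over \<open>k\<close> of
  \<open>\<gamma>\<^sub>k (\<Delta>\<^sup>k p)(0)\<close>, where \<open>1 / \<gamma>\<^sub>k\<close> is the product of \<open>2 (i + 1) (N + 2 i)\<close> over \<open>i < k\<close>.
  This is a spherical mean because \<open>\<Delta>\<close> commutes with the rotations \<open>M\<^sub>j\<^sub>k\<close> and lowers powers of the
  squared radius \<open>\<rho>\<close>. It is the only one: summing \<open>\<lambda>\<^sub>0(\<rho>\<^sup>n M\<^sub>j\<^sub>k(X\<^sub>j \<partial>\<^sub>k p)) = 0\<close> over \<open>j\<close> and \<open>k\<close>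
  gives \<open>d (N + d - 2) \<lambda>\<^sub>0(\<rho>\<^sup>n p) = \<lambda>\<^sub>0(\<rho>\<^sup>n\<^sup>+\<^sup>1 \<Delta>p)\<close> for \<open>p\<close> homogeneous of degree \<open>d\<close>, which
  reduces everything to constants.

  As \<open>\<Delta>\<close> commutes with translation, the mean-value property says that \<open>\<gamma>\<^sub>k \<Delta>\<^sup>k p\<close> sums to \<open>0\<close> over
  \<open>k \<ge> 1\<close>. If \<open>\<Delta>p\<close> were nonzero, take the last \<open>k\<close> with \<open>\<Delta>\<^sup>k p \<noteq> 0\<close>; applying \<open>\<Delta>\<^sup>k\<^sup>-\<^sup>1\<close> leaves
  \<open>\<gamma>\<^sub>1 \<Delta>\<^sup>k p = 0\<close>, although \<open>\<gamma>\<^sub>1\<close> is a unit.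
\<close>

section \<open>Polynomials\<close>

lemma mpoly_eq_sum_single:
  "p = (\<Sum>m\<in>Poly_Mapping.keys p. Poly_Mapping.single m (Poly_Mapping.lookup p m))"
  by (rule poly_mapping_eqI) (auto simp: lookup_sum lookup_single when_def in_keys_iff)

lemma mpoly_single_induct [case_names zero single add]:
  fixes p :: "('n, 'a::comm_monoid_add) mpoly"
  assumes "P 0" and "\<And>m c. P (Poly_Mapping.single m c)" and "\<And>p q. P p \<Longrightarrow> P q \<Longrightarrow> P (p + q)"
  shows "P p"
proof -
  have "P (\<Sum>m\<in>A. Poly_Mapping.single m (Poly_Mapping.lookup p m))" if "finite A" for A
    using that by induction (auto intro: assms)
  then show ?thesis by (subst mpoly_eq_sum_single) simp
qed

lemma single_eq_Const_mult_Vars: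
  fixes m :: "'n::finite \<Rightarrow>\<^sub>0 nat" and c :: "'a::comm_ring_1"
  shows "Poly_Mapping.single m c = Const c * (\<Prod>i\<in>UNIV. Var i ^ Poly_Mapping.lookup m i)"
proof -
  have pow: "(Var i :: ('n,'a) mpoly) ^ e = Poly_Mapping.single (Poly_Mapping.single i e) 1" for i e
    by (induction e) (simp_all add: Var_def mult_single single_add[symmetric])
  have "(\<Prod>i\<in>A. Poly_Mapping.single (f i) (1::'a)) = Poly_Mapping.single (\<Sum>i\<in>A. f i) 1"
    if "finite A" for A and f :: "'n \<Rightarrow> 'n \<Rightarrow>\<^sub>0 nat"
    using that by induction (simp_all add: mult_single)
  moreover have "(\<Sum>i\<in>UNIV. Poly_Mapping.single i (Poly_Mapping.lookup m i)) = m"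
    by (rule poly_mapping_eqI) (simp add: lookup_sum lookup_single when_def)
  ultimately show ?thesis by (simp add: pow Const_def mult_single)
qed

lemma Const_add: "Const (a + b) = Const a + Const b"
  by (simp add: Const_def single_add)

lemma Const_mult: "Const (a * b :: 'a::semiring_0) = (Const a * Const b :: ('n,'a) mpoly)"
  by (simp add: Const_def mult_single)

lemma Const_0 [simp]: "Const 0 = 0"
  by (simp add: Const_def)

lemma Const_1 [simp]: "Const 1 = 1"
  by (simp add: Const_def)

lemma Const_of_nat: "Const (of_nat n :: 'a::comm_semiring_1) = of_nat n"
  by (induction n) (simp_all add: Const_add)

text \<open>Constants and indeterminates generate the polynomial ring, since a monomial is a
  constant times powers of indeterminates. This makes identities about \<open>translate\<close> a
  check on generators.\<close>

lemma mpoly_induct [case_names Const Var add mult]: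
  fixes p :: "('n::finite, 'a::comm_ring_1) mpoly"
  assumes "\<And>c. P (Const c)" and "\<And>i. P (Var i)"
    and add: "\<And>p q. P p \<Longrightarrow> P q \<Longrightarrow> P (p + q)" and mult: "\<And>p q. P p \<Longrightarrow> P q \<Longrightarrow> P (p * q)"
  shows "P p"
proof (induction p rule: mpoly_single_induct)
  case zero show ?case using assms(1)[of 0] by simp
next
  case (single m c)
  have pow: "P (Var i ^ e)" for i e
    using assms(1)[of 1] by (induction e) (auto intro: assms(2) mult)
  have "P (\<Prod>i\<in>A. Var i ^ Poly_Mapping.lookup m i)" if "finite A" for A
    using that assms(1)[of 1] by induction (auto intro: pow mult)
  then show ?case
    unfolding single_eq_Const_mult_Vars by (intro mult assms(1)) simp
next
  case (add p q) then show ?case by (rule assms(3))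
qed

section \<open>Partial derivatives\<close>

text \<open>\<open>pd\<close> sums over a support that varies with \<open>p\<close>. Enlarging it
  adds only zero terms, so two polynomials can be compared over one index set.\<close>

lemma pd_extend:
  assumes "finite A" and "Poly_Mapping.keys p \<subseteq> A"
  shows "pd i p = (\<Sum>m\<in>A. Poly_Mapping.single (m - Poly_Mapping.single i 1)
       (of_nat (Poly_Mapping.lookup m i) * Poly_Mapping.lookup p m))"
  unfolding pd_def
  by (rule sum.mono_neutral_left) (use assms in \<open>auto simp: in_keys_iff\<close>)

lemma pd_add: "pd i (p + q) = pd i p + pd i q"
proof -
  let ?A = "Poly_Mapping.keys p \<union> Poly_Mapping.keys q"
  have "Poly_Mapping.keys (p + q) \<subseteq> ?A" by (rule Poly_Mapping.keys_add)
  then show ?thesis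
    by (simp add: pd_extend[of ?A] lookup_add distrib_left single_add sum.distrib)
qed

lemma pd_0 [simp]: "pd i 0 = 0"
  by (simp add: pd_def)

lemma pd_single:
  "pd i (Poly_Mapping.single m c) =
     Poly_Mapping.single (m - Poly_Mapping.single i 1) (of_nat (Poly_Mapping.lookup m i) * c)"
  by (cases "c = 0") (simp_all add: pd_def)

lemma pd_Const [simp]: "pd i (Const c) = 0"
  by (simp add: Const_def pd_single)

lemma pd_1 [simp]: "pd i 1 = 0"
  using pd_Const[of i 1] by simp

lemma pd_Var: "pd i (Var j :: ('n, 'a::comm_ring_1) mpoly) = (if i = j then 1 else 0)"
  by (auto simp: Var_def pd_single lookup_single)

lemma pd_mult: "pd i (p * q) = pd i p * q + p * pd i (q :: ('n, 'a::comm_ring_1) mpoly)"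
proof (induction p rule: mpoly_single_induct)
  case (single m c)
  show ?case
  proof (induction q rule: mpoly_single_induct)
    case (single m' c')
    \<comment> \<open>Truncated subtraction at \<open>i\<close> can be moved out of a sum when
      \<open>i\<close> occurs in the monomial being lowered; otherwise the coefficient is 0 and the
      exponent does not matter.\<close>
    have sub: "m - Poly_Mapping.single i 1 + m' = m + m' - Poly_Mapping.single i 1"
      if "Poly_Mapping.lookup m i \<noteq> 0" for m m' :: "'n \<Rightarrow>\<^sub>0 nat"
      by (rule poly_mapping_eqI) (use that in \<open>auto simp: lookup_add lookup_minus lookup_single when_def\<close>)
    have 1: "Poly_Mapping.single (m - Poly_Mapping.single i 1 + m') (of_nat (Poly_Mapping.lookup m i) * (c * c'))
      = Poly_Mapping.single (m + m' - Poly_Mapping.single i 1) (of_nat (Poly_Mapping.lookup m i) * (c * c'))"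
      using sub[of m m'] by (cases "Poly_Mapping.lookup m i = 0") simp_all
    have 2: "Poly_Mapping.single (m + (m' - Poly_Mapping.single i 1)) (of_nat (Poly_Mapping.lookup m' i) * (c * c'))
      = Poly_Mapping.single (m + m' - Poly_Mapping.single i 1) (of_nat (Poly_Mapping.lookup m' i) * (c * c'))"
      using sub[of m' m] by (cases "Poly_Mapping.lookup m' i = 0") (simp_all add: add.commute)
    show ?case
      using 1 2 by (simp add: pd_single mult_single lookup_add distrib_right single_add mult.assoc mult.left_commute[of c])
  qed (simp_all add: pd_add algebra_simps)
qed (simp_all add: pd_add algebra_simps)

lemma pd_commute: "pd i (pd j p) = pd j (pd i (p :: ('n, 'a::comm_ring_1) mpoly))"
proof (induction p rule: mpoly_single_induct)
  case (single m c)
  have "m - Poly_Mapping.single i 1 - Poly_Mapping.single j 1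
      = m - Poly_Mapping.single j 1 - Poly_Mapping.single i 1"
    by (rule poly_mapping_eqI) (simp add: lookup_minus)
  then show ?case
    by (cases "i = j") (simp_all add: pd_single lookup_minus lookup_single mult_ac)
qed (simp_all add: pd_add)

lemma pd_Const_mult: "pd i (Const c * p) = Const c * pd i (p :: ('n, 'a::comm_ring_1) mpoly)"
  by (simp add: pd_mult)

lemma pd_sum: "pd i (sum f A) = (\<Sum>a\<in>A. pd i (f a))"
  by (induction A rule: infinite_finite_induct) (simp_all add: pd_add)

lemma pd_uminus: "pd i (- p) = - pd i (p :: ('n, 'a::comm_ring_1) mpoly)"
  using pd_add[of i p "- p"] by (simp add: eq_neg_iff_add_eq_0 add.commute)

lemma pd_diff: "pd i (p - q) = pd i p - pd i (q :: ('n, 'a::comm_ring_1) mpoly)"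
  using pd_add[of i p "- q"] by (simp add: pd_uminus)

text \<open>The coefficient of \<open>pd i p\<close> at \<open>m\<close> is a multiple of the
  coefficient of \<open>p\<close> at \<open>m\<close> times \<open>X_i\<close>, because only that
  monomial can be lowered to \<open>m\<close> with a nonzero factor.\<close>

lemma keys_pd:
  fixes p :: "('n, 'a::comm_ring_1) mpoly"
  assumes "m \<in> Poly_Mapping.keys (pd i p)"
  shows "m + Poly_Mapping.single i 1 \<in> Poly_Mapping.keys p"
proof -
  have "Poly_Mapping.lookup (pd i p) m =
      of_nat (Suc (Poly_Mapping.lookup m i)) * Poly_Mapping.lookup p (m + Poly_Mapping.single i 1)"
  proof (induction p rule: mpoly_single_induct)
    case (single m' c)
    show ?case
    proof (cases "m' = m + Poly_Mapping.single i 1")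
      case True then show ?thesis by (simp add: pd_single lookup_add)
    next
      case False
      have "Poly_Mapping.lookup m' i = 0" if "m' - Poly_Mapping.single i 1 = m"
      proof (rule ccontr)
        assume "Poly_Mapping.lookup m' i \<noteq> 0"
        then have "m' = m + Poly_Mapping.single i 1"
          unfolding that[symmetric]
          by (intro poly_mapping_eqI) (auto simp: lookup_add lookup_minus lookup_single when_def)
        with False show False ..
      qed
      with False show ?thesis by (auto simp: pd_single lookup_single when_def)
    qed
  qed (simp_all add: pd_add lookup_add algebra_simps)
  with assms show ?thesis by (auto simp: in_keys_iff)
qed

section \<open>Evaluation\<close>

context
  fixes h :: "'a::comm_ring_1 \<Rightarrow> 'b::comm_ring_1" and f :: "'n::finite \<Rightarrow> 'b"
  assumes h_add: "\<And>a b. h (a + b) = h a + h b" and h_mult: "\<And>a b. h (a * b) = h a * h b"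
    and h_1: "h 1 = 1"
begin

lemma hom_zero: "h 0 = 0"
  using h_add[of 0 0] by simp

lemma eval_mpoly_extend:
  assumes "finite A" and "Poly_Mapping.keys p \<subseteq> A"
  shows "eval_mpoly h f p =
    (\<Sum>m\<in>A. h (Poly_Mapping.lookup p m) * (\<Prod>i\<in>UNIV. f i ^ Poly_Mapping.lookup m i))"
  unfolding eval_mpoly_def
  by (rule sum.mono_neutral_left) (use assms hom_zero in \<open>auto simp: in_keys_iff\<close>)

lemma eval_mpoly_add: "eval_mpoly h f (p + q) = eval_mpoly h f p + eval_mpoly h f q"
proof -
  let ?A = "Poly_Mapping.keys p \<union> Poly_Mapping.keys q"
  have "Poly_Mapping.keys (p + q) \<subseteq> ?A" by (rule Poly_Mapping.keys_add)
  then show ?thesis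
    by (simp add: eval_mpoly_extend[of ?A] lookup_add h_add distrib_right sum.distrib)
qed

lemma eval_mpoly_single:
  "eval_mpoly h f (Poly_Mapping.single m c) = h c * (\<Prod>i\<in>UNIV. f i ^ Poly_Mapping.lookup m i)"
  by (cases "c = 0") (simp_all add: eval_mpoly_def hom_zero)

lemma eval_mpoly_Const: "eval_mpoly h f (Const c) = h c"
  by (simp add: Const_def eval_mpoly_single)

lemma eval_mpoly_Var: "eval_mpoly h f (Var i) = f i"
proof -
  have "(\<Prod>j\<in>UNIV. f j ^ Poly_Mapping.lookup (Poly_Mapping.single i 1) j)
      = (\<Prod>j\<in>UNIV. if j = i then f j else 1)"
    by (rule prod.cong) (auto simp: lookup_single when_def)
  then show ?thesis by (simp add: Var_def eval_mpoly_single h_1)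
qed

lemma eval_mpoly_mult: "eval_mpoly h f (p * q) = eval_mpoly h f p * eval_mpoly h f q"
proof (induction p rule: mpoly_single_induct)
  case (single m c)
  show ?case
  proof (induction q rule: mpoly_single_induct)
    case (single m' c')
    show ?case
      by (simp add: eval_mpoly_single mult_single lookup_add h_mult power_add prod.distrib mult_ac)
  qed (simp_all add: eval_mpoly_add distrib_left, simp_all add: eval_mpoly_def)
qed (simp_all add: eval_mpoly_add distrib_right, simp_all add: eval_mpoly_def)

end

section \<open>Evaluation at the origin and translation\<close>

definition eval0 :: "('n::finite, 'a::comm_ring_1) mpoly \<Rightarrow> 'a" where
  "eval0 = eval_mpoly (\<lambda>c. c) (\<lambda>_. 0)"

lemma eval0_add: "eval0 (p + q) = eval0 p + eval0 q"
  and eval0_mult: "eval0 (p * q) = eval0 p * eval0 q"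
  and eval0_Const [simp]: "eval0 (Const c) = c"
  and eval0_Var [simp]: "eval0 (Var i) = 0"
  unfolding eval0_def
  by (simp_all add: eval_mpoly_add eval_mpoly_mult eval_mpoly_Const eval_mpoly_Var)

lemma eval0_0 [simp]: "eval0 0 = 0" and eval0_1 [simp]: "eval0 1 = 1"
  using eval0_Const[of 0] eval0_Const[of 1] by simp_all

lemma eval0_diff: "eval0 (p - q) = eval0 p - eval0 q"
  using eval0_add[of "p - q" q] by simp

lemma eval0_sum: "eval0 (sum f A) = (\<Sum>a\<in>A. eval0 (f a))"
  by (induction A rule: infinite_finite_induct) (simp_all add: eval0_add)

lemma eval0_power: "eval0 (p ^ n) = eval0 p ^ n"
  by (induction n) (simp_all add: eval0_mult)

lemma translate_add: "translate (p + q) = translate p + translate q"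
  and translate_mult: "translate (p * q) = translate p * translate q"
  and translate_Const: "translate (Const c) = Const (Const c)"
  and translate_Var: "translate (Var i) = Var i + Const (Var i)"
  unfolding translate_def
  by (simp_all add: eval_mpoly_add eval_mpoly_mult eval_mpoly_Const eval_mpoly_Var
      Const_add Const_mult)

lemma translate_0: "translate 0 = 0" and translate_1: "translate 1 = 1"
  using translate_Const[of 0] translate_Const[of 1] by simp_all

lemma translate_sum: "translate (sum f A) = (\<Sum>a\<in>A. translate (f a))"
  by (induction A rule: infinite_finite_induct) (simp_all add: translate_add translate_0)

text \<open>Putting X = 0 in p(X + t) leaves p(t); this turns Pizzetti's formula for
  \<open>translate p\<close> into an identity in R[t].\<close>

lemma eval0_translate: "eval0 (translate p) = p"
  by (induction p rule: mpoly_induct)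
     (simp_all add: translate_Const translate_Var translate_add translate_mult eval0_add eval0_mult)

text \<open>The outer \<open>pd\<close> treats each t_i as a constant, so X_i + t_i has the same
  derivatives as X_i; the product rule carries this to all polynomials.\<close>

lemma pd_translate: "pd i (translate p) = translate (pd i p)"
  by (induction p rule: mpoly_induct)
     (simp_all add: translate_Const translate_Var translate_add translate_mult pd_add pd_mult pd_Var
       translate_0 translate_1)

section \<open>The Laplacian\<close>

lemma laplacian_add: "laplacian (p + q) = laplacian p + laplacian q"
  by (simp add: laplacian_def pd_add sum.distrib)

lemma laplacian_0 [simp]: "laplacian 0 = 0"
  by (simp add: laplacian_def)

lemma laplacian_diff: "laplacian (p - q) = laplacian p - laplacian (q :: ('n::finite, 'a::comm_ring_1) mpoly)"
  by (simp add: laplacian_def pd_diff sum_subtractf)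

lemma laplacian_Const_mult:
  "laplacian (Const c * p) = Const c * laplacian (p :: ('n::finite, 'a::comm_ring_1) mpoly)"
  by (simp add: laplacian_def pd_Const_mult sum_distrib_left)

lemma laplacian_pd: "laplacian (pd i p) = pd i (laplacian (p :: ('n::finite, 'a::comm_ring_1) mpoly))"
  unfolding laplacian_def pd_sum by (metis pd_commute)

lemma laplacian_Var_mult:
  "laplacian (Var j * p) = Var j * laplacian p + 2 * pd j (p :: ('n::finite, 'a::comm_ring_1) mpoly)"
proof -
  have "pd i (pd i (Var j * p)) = Var j * pd i (pd i p) + (if i = j then 2 * pd j p else 0)" for i
    by (simp add: pd_mult pd_add pd_Var)
  then show ?thesis
    by (simp add: laplacian_def sum.distrib sum_distrib_left)
qed

text \<open>Moving the Laplacian past X_j and X_k leaves the error terms 2 \<partial>_j \<partial>_k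
  p and 2 \<partial>_k \<partial>_j p, which cancel.\<close>

lemma laplacian_rot: "laplacian (rot j k p) = rot j k (laplacian (p :: ('n::finite, 'a::comm_ring_1) mpoly))"
  by (simp add: rot_def laplacian_diff laplacian_Var_mult laplacian_pd pd_commute[of j k])

lemma laplacian_translate: "laplacian (translate p) = translate (laplacian p)"
  by (simp add: laplacian_def translate_sum pd_translate)

lemma funpow_laplacian_0 [simp]: "(laplacian ^^ k) 0 = 0"
  by (induction k) simp_all

lemma funpow_laplacian_add: "(laplacian ^^ k) (p + q) = (laplacian ^^ k) p + (laplacian ^^ k) q"
  by (induction k) (simp_all add: laplacian_add)

lemma funpow_laplacian_sum: "(laplacian ^^ k) (sum f A) = (\<Sum>a\<in>A. (laplacian ^^ k) (f a))"
  by (induction A rule: infinite_finite_induct) (simp_all add: funpow_laplacian_add)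

lemma funpow_laplacian_Const_mult:
  "(laplacian ^^ k) (Const c * p) = Const c * (laplacian ^^ k) (p :: ('n::finite, 'a::comm_ring_1) mpoly)"
  by (induction k) (simp_all add: laplacian_Const_mult)

lemma funpow_laplacian_rot:
  "(laplacian ^^ k) (rot j i p) = rot j i ((laplacian ^^ k) (p :: ('n::finite, 'a::comm_ring_1) mpoly))"
  by (induction k) (simp_all add: laplacian_rot)

lemma funpow_laplacian_translate: "(laplacian ^^ k) (translate p) = translate ((laplacian ^^ k) p)"
  by (induction k) (simp_all add: laplacian_translate)

lemma funpow_laplacian_mono:
  assumes "(laplacian ^^ k) p = 0" and "k \<le> l"
  shows "(laplacian ^^ l) p = 0"
proof -
  have "(laplacian ^^ l) p = (laplacian ^^ (l - k)) ((laplacian ^^ k) p)"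
    using assms(2) by (simp flip: funpow_add[THEN fun_cong, simplified])
  with assms(1) show ?thesis by simp
qed

section \<open>Total degree and nilpotence of the Laplacian\<close>

definition mdeg :: "('n::finite \<Rightarrow>\<^sub>0 nat) \<Rightarrow> nat" where
  "mdeg m = (\<Sum>i\<in>UNIV. Poly_Mapping.lookup m i)"

lemma mdeg_add_single [simp]: "mdeg (m + Poly_Mapping.single i (Suc 0)) = Suc (mdeg m)"
  by (simp add: mdeg_def lookup_add sum.distrib lookup_single when_def)

lemma keys_laplacian:
  fixes p :: "('n::finite, 'a::comm_ring_1) mpoly"
  assumes "m \<in> Poly_Mapping.keys (laplacian p)"
  shows "\<exists>m' \<in> Poly_Mapping.keys p. mdeg m' = mdeg m + 2"
proof -
  obtain i where "m \<in> Poly_Mapping.keys (pd i (pd i p))"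
    using assms unfolding laplacian_def in_keys_iff lookup_sum
    by (meson sum.not_neutral_contains_not_neutral)
  then have "m + Poly_Mapping.single i 1 + Poly_Mapping.single i 1 \<in> Poly_Mapping.keys p"
    by (intro keys_pd)
  then show ?thesis by (rule bexI[rotated]) simp
qed

text \<open>Each application lowers every degree by two. Counting a drop of only one per application
  already suffices.\<close>

lemma laplacian_nilpotent: "\<exists>k. (laplacian ^^ k) (p :: ('n::finite, 'a::comm_ring_1) mpoly) = 0"
proof -
  have *: "(laplacian ^^ d) p = 0" if "\<forall>m\<in>Poly_Mapping.keys p. mdeg m < d"
    for d and p :: "('n, 'a) mpoly"
    using that
  proof (induction d arbitrary: p)
    case 0 then show ?case by simp
  next
    case (Suc d)
    have "(laplacian ^^ d) (laplacian p) = 0"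
      by (rule Suc.IH) (use Suc.prems keys_laplacian in fastforce)
    then show ?case by (simp add: funpow_swap1)
  qed
  \<comment> \<open>For p = 0 the \<open>Max\<close> of the empty set is unspecified, but then there
    is no monomial to bound.\<close>
  show ?thesis
    by (rule exI, rule *[where d = "Suc (Max (mdeg ` Poly_Mapping.keys p))"])
       (auto simp: less_Suc_eq_le)
qed

section \<open>Homogeneous polynomials\<close>

definition homog :: "nat \<Rightarrow> ('n::finite, 'a::comm_ring_1) mpoly \<Rightarrow> bool" where
  "homog d p \<longleftrightarrow> (\<forall>m\<in>Poly_Mapping.keys p. mdeg m = d)"

lemma homog_pd: "homog (Suc d) p \<Longrightarrow> homog d (pd i p)"
  unfolding homog_def by (force dest: keys_pd)

text \<open>For d < 2 the Laplacian vanishes, so the truncated \<open>d - 2\<close> does no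
  harm.\<close>

lemma homog_laplacian: "homog d p \<Longrightarrow> homog (d - 2) (laplacian p)"
  unfolding homog_def using keys_laplacian by fastforce

lemma homog_0_Const:
  assumes "homog 0 p"
  shows "\<exists>c. p = Const c"
proof -
  have "m = 0" if "m \<in> Poly_Mapping.keys p" for m
    using assms that by (auto simp: homog_def mdeg_def intro: poly_mapping_eqI)
  then have "p = Const (Poly_Mapping.lookup p 0)"
    by (intro poly_mapping_eqI) (auto simp: Const_def lookup_single when_def in_keys_iff)
  then show ?thesis ..
qed

lemma Var_mult_pd_single:
  "Var i * pd i (Poly_Mapping.single m c) =
     of_nat (Poly_Mapping.lookup m i) * Poly_Mapping.single m (c::'a::comm_ring_1)"
proof -
  have "Poly_Mapping.single i 1 + (m - Poly_Mapping.single i 1) = m" if "Poly_Mapping.lookup m i \<noteq> 0"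
    by (rule poly_mapping_eqI) (use that in \<open>auto simp: lookup_add lookup_minus lookup_single when_def\<close>)
  then show ?thesis
    unfolding Const_of_nat[symmetric]
    by (cases "Poly_Mapping.lookup m i = 0")
       (simp_all add: pd_single Var_def Const_def mult_single del: single_of_nat)
qed

lemma euler_homog:
  fixes p :: "('n::finite, 'a::comm_ring_1) mpoly"
  assumes "homog d p"
  shows "(\<Sum>i\<in>UNIV. Var i * pd i p) = of_nat d * p"
proof -
  have "(\<Sum>i\<in>UNIV. Var i * pd i p) = (\<Sum>i\<in>UNIV. \<Sum>m\<in>Poly_Mapping.keys p.
      of_nat (Poly_Mapping.lookup m i) * Poly_Mapping.single m (Poly_Mapping.lookup p m))"
    by (subst mpoly_eq_sum_single[of p]) (simp add: pd_sum sum_distrib_left Var_mult_pd_single)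
  also have "\<dots> = (\<Sum>m\<in>Poly_Mapping.keys p. of_nat (mdeg m) * Poly_Mapping.single m (Poly_Mapping.lookup p m))"
    by (subst sum.swap) (simp add: mdeg_def sum_distrib_right)
  also have "\<dots> = (\<Sum>m\<in>Poly_Mapping.keys p. of_nat d * Poly_Mapping.single m (Poly_Mapping.lookup p m))"
    by (rule sum.cong) (use assms in \<open>auto simp: homog_def\<close>)
  also have "\<dots> = of_nat d * p"
    by (subst (2) mpoly_eq_sum_single[of p]) (simp add: sum_distrib_left)
  finally show ?thesis .
qed

section \<open>Powers of the squared radius\<close>

definition rsq :: "('n::finite, 'a::comm_ring_1) mpoly" where
  "rsq = (\<Sum>i\<in>UNIV. Var i ^ 2)"

lemma pd_rsq: "pd i rsq = (2 * Var i :: ('n::finite, 'a::comm_ring_1) mpoly)"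
proof -
  have "pd i (Var j ^ 2) = (if j = i then 2 * Var i else (0 :: ('n, 'a) mpoly))" for j
    by (auto simp: power2_eq_square pd_mult pd_Var)
  then show ?thesis by (simp add: rsq_def pd_sum)
qed

lemma pd_rsq_power: 
  "pd i (rsq ^ Suc n :: ('n::finite, 'a::comm_ring_1) mpoly) = of_nat (2 * Suc n) * Var i * rsq ^ n"
proof (induction n)
  case 0 show ?case by (simp add: pd_rsq)
next
  case (Suc n)
  have "pd i (rsq ^ Suc (Suc n) :: ('n, 'a) mpoly) =
      2 * Var i * rsq ^ Suc n + rsq * (of_nat (2 * Suc n) * Var i * rsq ^ n)"
    by (subst power_Suc) (simp only: pd_mult pd_rsq Suc)
  then show ?case by (simp add: algebra_simps)
qed

lemma euler_rsq_power:
  "(\<Sum>i\<in>UNIV. Var i * pd i (rsq ^ n)) = (of_nat (2 * n) * rsq ^ n :: ('n::finite, 'a::comm_ring_1) mpoly)"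
proof (cases n)
  case 0 then show ?thesis by simp
next
  case (Suc m)
  have "(\<Sum>i\<in>UNIV. Var i * pd i (rsq ^ Suc m)) =
      (\<Sum>i\<in>UNIV. of_nat (2 * Suc m) * rsq ^ m * Var i ^ 2 :: ('n, 'a) mpoly)"
    unfolding pd_rsq_power by (rule sum.cong) (simp_all add: power2_eq_square mult_ac)
  also have "\<dots> = of_nat (2 * Suc m) * rsq ^ Suc m"
    by (simp only: sum_distrib_left[symmetric] rsq_def[symmetric] power_Suc2 mult.assoc)
  finally show ?thesis using Suc by simp
qed

text \<open>The scalar by which the Laplacian takes \<rho>^(n+1) to \<rho>^n, kept as a natural
  number so that its positivity is plain and its inverse comes from the rationals.\<close>

definition lap_factor :: "'n itself \<Rightarrow> nat \<Rightarrow> nat" where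
  "lap_factor _ n = 2 * Suc n * (CARD('n) + 2 * n)"

lemma pd_of_nat_mult: "pd i (of_nat n * p) = of_nat n * pd i (p :: ('n, 'a::comm_ring_1) mpoly)"
  using pd_Const_mult[of i "of_nat n" p] by (simp add: Const_of_nat)

text \<open>Differentiating 2(n+1) X_i \<rho>^n once more and summing over i gives N copies of
  \<rho>^n from the X_i, and 2n copies from Euler's identity for \<rho>^n.\<close>

lemma laplacian_rsq_power:
  "laplacian (rsq ^ Suc n :: ('n::finite, 'a::comm_ring_1) mpoly) =
     of_nat (lap_factor TYPE('n) n) * rsq ^ n"
proof -
  have "laplacian (rsq ^ Suc n :: ('n, 'a) mpoly) =
      (\<Sum>i\<in>UNIV. of_nat (2 * Suc n) * (rsq ^ n + Var i * pd i (rsq ^ n)))"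
    unfolding laplacian_def pd_rsq_power
    by (simp only: mult.assoc pd_of_nat_mult pd_mult[of _ "Var _"] pd_Var) simp
  also have "\<dots> = of_nat (2 * Suc n) * (of_nat CARD('n) * rsq ^ n + of_nat (2 * n) * rsq ^ n)"
    by (simp only: sum_distrib_left[symmetric] sum.distrib euler_rsq_power) simp
  finally show ?thesis by (simp add: lap_factor_def algebra_simps)
qed

lemma funpow_laplacian_rsq:
  "(laplacian ^^ k) (rsq ^ (k + n) :: ('n::finite, 'a::comm_ring_1) mpoly) =
     Const (of_nat (\<Prod>i<k. lap_factor TYPE('n) (n + i))) * rsq ^ n"
proof (induction k arbitrary: n)
  case (Suc k)
  have "(laplacian ^^ Suc k) (rsq ^ (Suc k + n) :: ('n, 'a) mpoly) = laplacian ((laplacian ^^ k) (rsq ^ (k + Suc n)))"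
    by simp
  also have "\<dots> = Const (of_nat (\<Prod>i<k. lap_factor TYPE('n) (Suc n + i))) * laplacian (rsq ^ Suc n)"
    unfolding Suc laplacian_Const_mult ..
  also have "\<dots> = Const (of_nat (\<Prod>i<Suc k. lap_factor TYPE('n) (n + i))) * rsq ^ n"
    unfolding laplacian_rsq_power prod.lessThan_Suc_shift Const_of_nat
    by (simp only: of_nat_mult mult_ac add_0_right add_Suc_right add_Suc)
  finally show ?case .
qed simp

text \<open>A rotation is a derivation, and it kills powers of \<rho> because their gradient is a
  multiple of X.\<close>

lemma rot_rsq_power_mult:
  "rot j k (rsq ^ n * p) = rsq ^ n * rot j k (p :: ('n::finite, 'a::comm_ring_1) mpoly)"
proof -
  have "rot j k (rsq ^ n) = (0 :: ('n, 'a) mpoly)"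
    by (cases n) (simp_all only: rot_def pd_rsq_power, simp_all add: mult_ac)
  moreover have "rot j k (rsq ^ n * p) = rot j k (rsq ^ n) * p + rsq ^ n * rot j k p"
    by (simp add: rot_def pd_mult algebra_simps)
  ultimately show ?thesis by simp
qed

section \<open>The spherical mean\<close>

lemma sum_rot_Var_mult:
  fixes q :: "('n::finite, 'a::comm_ring_1) mpoly"
  shows "(\<Sum>j\<in>UNIV. rot j k (Var j * q)) =
     rsq * pd k q + Var k * q - of_nat CARD('n) * (Var k * q) - Var k * (\<Sum>j\<in>UNIV. Var j * pd j q)"
proof -
  have "rot j k (Var j * q) = Var j ^ 2 * pd k q + (if j = k then Var k * q else 0)
      - Var k * q - Var k * (Var j * pd j q)" for j
    by (simp add: rot_def pd_mult pd_Var power2_eq_square algebra_simps)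
  then show ?thesis
    by (simp add: sum_subtractf sum.distrib rsq_def sum_distrib_left sum_distrib_right)
qed

text \<open>Take q = \<partial>_k p in the previous sum, which is homogeneous of degree e, and use
  Euler's identity for q and then for p. With d = e + 1 the scalar is d (N + d - 2).\<close>

lemma sum_rot_Var_mult_pd:
  fixes p :: "('n::finite, 'a::comm_ring_1) mpoly"
  assumes "homog (Suc e) p"
  shows "(\<Sum>k\<in>UNIV. \<Sum>j\<in>UNIV. rot j k (Var j * pd k p)) =
     rsq * laplacian p - of_nat ((CARD('n) - 1 + e) * Suc e) * p"
proof -
  have "(\<Sum>k\<in>UNIV. \<Sum>j\<in>UNIV. rot j k (Var j * pd k p)) =
      (\<Sum>k\<in>UNIV. rsq * pd k (pd k p) + Var k * pd k p - of_nat CARD('n) * (Var k * pd k p)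
        - of_nat e * (Var k * pd k p))"
    by (simp add: sum_rot_Var_mult euler_homog[OF homog_pd[OF assms]] mult_ac)
  also have "\<dots> = rsq * laplacian p - (of_nat CARD('n) - 1 + of_nat e) * (of_nat (Suc e) * p)"
    by (simp only: sum_subtractf sum.distrib sum_distrib_left[symmetric] euler_homog[OF assms]
        laplacian_def[symmetric]) (simp only: algebra_simps mult_1)
  \<comment> \<open>As N is at least 1, truncated subtraction of 1 agrees with subtraction in the
    ring.\<close>
  also have "(of_nat CARD('n) - 1 + of_nat e :: ('n, 'a) mpoly) = of_nat (CARD('n) - 1 + e)"
    using of_nat_diff[of 1 "CARD('n)", where 'a = "('n, 'a) mpoly"]
    by (simp only: of_nat_add of_nat_1) (simp add: Suc_le_eq)
  finally show ?thesis by (simp only: of_nat_mult mult.assoc)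
qed

context
  fixes L :: "('n::finite, 's::comm_ring_1) mpoly \<Rightarrow> 's"
  assumes L: "is_spherical_mean L"
begin

lemma mean_add: "L (p + q) = L p + L q"
  and mean_Const_mult: "L (Const c * p) = c * L p"
  using L unfolding is_spherical_mean_def by (metis module_hom.add module_hom.scale)+

lemma mean_0: "L 0 = 0"
  using mean_add[of 0 0] by simp

lemma mean_diff: "L (p - q) = L p - L q"
  using mean_add[of "p - q" q] by simp

lemma mean_sum: "L (sum f A) = (\<Sum>a\<in>A. L (f a))"
  by (induction A rule: infinite_finite_induct) (simp_all add: mean_0 mean_add)

lemma mean_rot: "L (rot j k p) = 0"
  using L by (cases "j = k") (simp_all add: is_spherical_mean_def rot_def mean_0)

lemma mean_rsq_power: "L (rsq ^ n) = 1"
  using L by (simp add: is_spherical_mean_def rsq_def)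

text \<open>Powers of \<rho> pass through rotations, so the double sum times \<rho>^n is a sum of
  rotations and has mean 0. The result trades a positive degree of p for a higher power of
  \<rho>.\<close>

lemma mean_rsq_power_mult_homog:
  assumes "homog (Suc e) p"
  shows "of_nat ((CARD('n) - 1 + e) * Suc e) * L (rsq ^ n * p) = L (rsq ^ Suc n * laplacian p)"
proof -
  let ?c = "(CARD('n) - 1 + e) * Suc e"
  have "0 = (\<Sum>k\<in>UNIV. \<Sum>j\<in>UNIV. L (rot j k (rsq ^ n * (Var j * pd k p))))"
    by (simp add: mean_rot)
  also have "\<dots> = L (rsq ^ n * (rsq * laplacian p - of_nat ?c * p))"
    by (simp only: rot_rsq_power_mult mean_sum[symmetric] sum_distrib_left[symmetric] sum_rot_Var_mult_pd[OF assms])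
  also have "\<dots> = L (rsq ^ Suc n * laplacian p - Const (of_nat ?c) * (rsq ^ n * p))"
    unfolding Const_of_nat by (simp only: right_diff_distrib power_Suc2 mult_ac)
  also have "\<dots> = L (rsq ^ Suc n * laplacian p) - of_nat ?c * L (rsq ^ n * p)"
    unfolding mean_diff mean_Const_mult ..
  finally show ?thesis by simp
qed

end

text \<open>A locale because two instances are needed: R itself, and R[t], over which the mean is
  taken.\<close>

locale rat_algebra =
  fixes \<iota> :: "rat \<Rightarrow> 's::comm_ring_1"
  assumes hom_1: "\<iota> 1 = 1"
    and hom_add: "\<iota> (x + y) = \<iota> x + \<iota> y"
    and hom_mult: "\<iota> (x * y) = \<iota> x * \<iota> y"
begin

lemma hom_of_nat: "\<iota> (of_nat n) = of_nat n"
  using hom_add[of 0 0] by (induction n) (simp_all add: hom_1 hom_add)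

lemma hom_inverse: "n > 0 \<Longrightarrow> \<iota> (1 / of_nat n) * of_nat n = 1"
  unfolding hom_of_nat[symmetric] hom_mult[symmetric] by (simp add: hom_1)

lemma of_nat_cancel:
  assumes "n > 0" and "of_nat n * x = of_nat n * (y :: 's)"
  shows "x = y"
  using hom_inverse[OF assms(1)] assms(2) by (metis mult.assoc mult_1)

text \<open>Strong induction on the degree, for all powers of \<rho> at once since each step raises
  that power. It ends at constants, where both maps are fixed by their values on \<rho>^n.\<close>

lemma spherical_mean_unique:
  fixes L L' :: "('n::finite, 's) mpoly \<Rightarrow> 's"
  assumes N: "CARD('n) \<ge> 2" and L: "is_spherical_mean L" and L': "is_spherical_mean L'"
  shows "L = L'"
proof
  have homog: "L (rsq ^ n * p) = L' (rsq ^ n * p)" if "homog d p" for d n p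
    using that
  proof (induction d arbitrary: n p rule: less_induct)
    case (less d)
    show ?case
    proof (cases d)
      case 0
      then obtain c where "p = Const c" using homog_0_Const less.prems by blast
      then show ?thesis
        by (simp add: mult.commute[of _ "Const c"] mean_Const_mult[OF L] mean_Const_mult[OF L']
            mean_rsq_power[OF L] mean_rsq_power[OF L'])
    next
      case (Suc e)
      let ?c = "(CARD('n) - 1 + e) * Suc e"
      have hom: "homog (Suc e) p" using less.prems Suc by simp
      have "of_nat ?c * L (rsq ^ n * p) = L (rsq ^ Suc n * laplacian p)"
        by (rule mean_rsq_power_mult_homog[OF L hom])
      also have "\<dots> = L' (rsq ^ Suc n * laplacian p)"
        by (rule less.IH[OF _ homog_laplacian[OF less.prems]]) (simp add: Suc)
      also have "\<dots> = of_nat ?c * L' (rsq ^ n * p)"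
        by (rule mean_rsq_power_mult_homog[OF L' hom, symmetric])
      \<comment> \<open>At e = 0 the scalar is N - 1, which is positive because N is at least
        2.\<close>
      finally show ?thesis by (rule of_nat_cancel[rotated]) (use N in simp)
    qed
  qed
  show "L p = L' p" for p
  proof (induction p rule: mpoly_single_induct)
    case (single m c)
    have "homog (mdeg m) (Poly_Mapping.single m c)" by (simp add: homog_def)
    from homog[OF this, of 0] show ?case by simp
  qed (simp_all add: mean_add[OF L] mean_add[OF L'] mean_0[OF L] mean_0[OF L'])
qed

section \<open>Existence through Pizzetti's formula\<close>

definition pizzetti_coeff :: "'n itself \<Rightarrow> nat \<Rightarrow> 's" where
  "pizzetti_coeff N k = \<iota> (1 / of_nat (\<Prod>i<k. lap_factor N i))"

text \<open>The index set is finite by nilpotence of the Laplacian, so the infinite series becomes a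
  total definition without choosing a degree bound.\<close>

definition pizzetti_mean :: "('n::finite, 's) mpoly \<Rightarrow> 's" where
  "pizzetti_mean p = (\<Sum>k | (laplacian ^^ k) p \<noteq> 0. pizzetti_coeff TYPE('n) k * eval0 ((laplacian ^^ k) p))"

lemma pizzetti_mean_eq:
  fixes p :: "('n::finite, 's) mpoly"
  assumes "(laplacian ^^ K) p = 0"
  shows "pizzetti_mean p = (\<Sum>k<K. pizzetti_coeff TYPE('n) k * eval0 ((laplacian ^^ k) p))"
  unfolding pizzetti_mean_def
proof (rule sum.mono_neutral_left)
  show "{k. (laplacian ^^ k) p \<noteq> 0} \<subseteq> {..<K}"
    using funpow_laplacian_mono[OF assms] by (auto simp: not_less[symmetric])
qed auto

lemma pizzetti_mean_add: "pizzetti_mean (p + q) = pizzetti_mean p + pizzetti_mean q"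
proof -
  obtain k l where "(laplacian ^^ k) p = 0" "(laplacian ^^ l) q = 0"
    using laplacian_nilpotent by blast
  then have p: "(laplacian ^^ max k l) p = 0" and q: "(laplacian ^^ max k l) q = 0"
    by (auto elim: funpow_laplacian_mono)
  then have "(laplacian ^^ max k l) (p + q) = 0"
    by (simp add: funpow_laplacian_add)
  from pizzetti_mean_eq[OF this] show ?thesis
    unfolding pizzetti_mean_eq[OF p] pizzetti_mean_eq[OF q]
    by (simp add: funpow_laplacian_add eval0_add distrib_left sum.distrib)
qed

lemma pizzetti_mean_Const_mult: "pizzetti_mean (Const c * p) = c * pizzetti_mean p"
proof -
  obtain k where k: "(laplacian ^^ k) p = 0"
    using laplacian_nilpotent by blast
  then have "(laplacian ^^ k) (Const c * p) = 0"
    by (simp add: funpow_laplacian_Const_mult)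
  from pizzetti_mean_eq[OF this] show ?thesis
    unfolding pizzetti_mean_eq[OF k]
    by (simp add: funpow_laplacian_Const_mult eval0_mult sum_distrib_left mult.left_commute)
qed

text \<open>Iterated Laplacians of a rotation are again rotations, and a rotation has no constant
  term.\<close>

lemma pizzetti_mean_rot: "pizzetti_mean (rot i j p) = 0"
  by (simp add: pizzetti_mean_def funpow_laplacian_rot) (simp add: rot_def eval0_diff eval0_mult)

lemma lap_factor_pos: "lap_factor TYPE('n::finite) n > 0"
  by (simp add: lap_factor_def)

text \<open>Only the term k = n survives: for k < n a positive power of \<rho> is evaluated at the
  origin, and for k > n the iterated Laplacian is 0. The coefficients are chosen to make the
  surviving term 1.\<close>

lemma pizzetti_mean_rsq_power: "pizzetti_mean (rsq ^ n :: ('n::finite, 's) mpoly) = 1"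
proof -
  let ?r = "rsq ^ n :: ('n, 's) mpoly"
  have lap: "(laplacian ^^ k) ?r = Const (of_nat (\<Prod>i<k. lap_factor TYPE('n) (n - k + i))) * rsq ^ (n - k)"
    if "k \<le> n" for k
    using funpow_laplacian_rsq[of k "n - k", where 'n = 'n and 'a = 's] that by simp
  have rsq0: "eval0 (rsq :: ('n, 's) mpoly) = 0"
    by (simp add: rsq_def eval0_sum eval0_power)
  have "(laplacian ^^ Suc n) ?r = 0"
    using lap[of n] by (simp add: laplacian_def)
  then have "pizzetti_mean ?r = (\<Sum>k<Suc n. pizzetti_coeff TYPE('n) k * eval0 ((laplacian ^^ k) ?r))"
    by (rule pizzetti_mean_eq)
  also have "(\<Sum>k<n. pizzetti_coeff TYPE('n) k * eval0 ((laplacian ^^ k) ?r)) = 0"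
    by (rule sum.neutral) (simp add: lap eval0_mult eval0_power rsq0 zero_power)
  then have "(\<Sum>k<Suc n. pizzetti_coeff TYPE('n) k * eval0 ((laplacian ^^ k) ?r))
      = pizzetti_coeff TYPE('n) n * of_nat (\<Prod>i<n. lap_factor TYPE('n) i)"
    by (simp add: lap del: of_nat_prod)
  also have "\<dots> = 1"
    unfolding pizzetti_coeff_def by (rule hom_inverse) (simp add: prod_pos lap_factor_pos)
  finally show ?thesis .
qed

lemma is_spherical_mean_pizzetti_mean: "is_spherical_mean (pizzetti_mean :: ('n::finite, 's) mpoly \<Rightarrow> 's)"
  unfolding is_spherical_mean_def
proof (intro conjI allI impI)
  show "module_hom (\<lambda>c p. Const c * p) (*) (pizzetti_mean :: ('n, 's) mpoly \<Rightarrow> 's)"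
    by unfold_locales
       (simp_all add: pizzetti_mean_add pizzetti_mean_Const_mult Const_add Const_mult
         distrib_left distrib_right mult.assoc)
qed (simp_all add: pizzetti_mean_rot pizzetti_mean_rsq_power flip: rsq_def)

theorem spherical_mean_eq_pizzetti_mean:
  assumes "CARD('n::finite) \<ge> 2"
  shows "spherical_mean = (pizzetti_mean :: ('n, 's) mpoly \<Rightarrow> 's)"
  unfolding spherical_mean_def
  by (rule the_equality)
     (use is_spherical_mean_pizzetti_mean spherical_mean_unique[OF assms] in auto)

end

section \<open>The converse of the mean-value property\<close>

theorem proposition4p9:
  fixes \<iota> :: "rat \<Rightarrow> 'r::comm_ring_1"
    and p :: "('n::finite, 'r) mpoly"
  assumes "inj \<iota>"
    and "\<iota> 1 = 1"
    and "\<And>x y. \<iota> (x + y) = \<iota> x + \<iota> y"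
    and "\<And>x y. \<iota> (x * y) = \<iota> x * \<iota> y"
    and "CARD('n) \<ge> 2"
    and "spherical_mean (translate p) = p"
  shows "harmonic p"
proof (rule ccontr)
  assume "\<not> harmonic p"
  then have nonharm: "laplacian p \<noteq> 0" by (simp add: harmonic_def)
  interpret R: rat_algebra \<iota>
    by unfold_locales (use assms in auto)
  \<comment> \<open>\<open>translate p\<close> has coefficients in R[t], so its spherical mean is
    taken over that ring.\<close>
  interpret S: rat_algebra "\<lambda>x. Const (\<iota> x) :: ('n, 'r) mpoly"
    by unfold_locales (simp_all add: R.hom_1 R.hom_add R.hom_mult Const_add Const_mult)
  let ?a = "\<lambda>k. R.pizzetti_coeff TYPE('n) k"
  let ?\<Delta> = "\<lambda>k. laplacian ^^ k"
  define K where "K = (LEAST k. ?\<Delta> k p = 0)"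
  have K: "?\<Delta> K p = 0"
    unfolding K_def by (rule LeastI_ex) (rule laplacian_nilpotent)
  have least: "?\<Delta> k p \<noteq> 0" if "k < K" for k
    using that not_less_Least unfolding K_def by blast
  \<comment> \<open>K = 0 would give p = 0 and K = 1 would give \<Delta>p = 0. Hence the last
    nonvanishing iterate has index \<open>Suc k\<close> with K = k + 2.\<close>
  have "K \<noteq> 0" and "K \<noteq> 1"
    using K nonharm by (auto intro: ccontr)
  then obtain k where Kk: "K = k + 2"
    by (metis add_2_eq_Suc' One_nat_def old.nat.exhaust)
  have coeff: "S.pizzetti_coeff TYPE('n) k = Const (?a k)" for k
    by (simp add: S.pizzetti_coeff_def R.pizzetti_coeff_def)
  have "?\<Delta> K (translate p) = 0"
    by (simp add: funpow_laplacian_translate K translate_0)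
  then have "p = (\<Sum>i<K. Const (?a i) * ?\<Delta> i p)"
    using assms(6) unfolding S.spherical_mean_eq_pizzetti_mean[OF assms(5)]
    by (simp add: S.pizzetti_mean_eq coeff funpow_laplacian_translate eval0_translate)
  \<comment> \<open>The coefficient at index 0 is an empty product, so that term is p itself and
    cancels next.\<close>
  then have "p = p + (\<Sum>i<Suc k. Const (?a (Suc i)) * ?\<Delta> (Suc i) p)"
    by (simp add: Kk sum.lessThan_Suc_shift R.pizzetti_coeff_def R.hom_1 del: sum.lessThan_Suc funpow.simps)
  then have "0 = ?\<Delta> k (\<Sum>i<Suc k. Const (?a (Suc i)) * ?\<Delta> (Suc i) p)"
    by (simp del: sum.lessThan_Suc)
  also have "\<dots> = (\<Sum>i<Suc k. Const (?a (Suc i)) * ?\<Delta> (k + Suc i) p)"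
    by (simp only: funpow_laplacian_sum funpow_laplacian_Const_mult funpow_add comp_apply)
  \<comment> \<open>All terms with i > 0 involve an iterate of index at least k + 2 = K.\<close>
  also have "\<dots> = Const (?a 1) * ?\<Delta> (Suc k) p"
  proof -
    have "?\<Delta> (k + Suc (Suc i)) p = 0" for i
      by (rule funpow_laplacian_mono[OF K]) (simp add: Kk)
    then show ?thesis
      by (simp add: sum.lessThan_Suc_shift del: sum.lessThan_Suc funpow.simps)
  qed
  \<comment> \<open>Multiplying by 2N, the inverse of \<open>?a 1\<close>, leaves the iterate
    alone.\<close>
  finally have "of_nat (lap_factor TYPE('n) 0) * (Const (?a 1) * ?\<Delta> (Suc k) p) = 0" by simp
  moreover have "?a 1 * of_nat (lap_factor TYPE('n) 0) = 1"
    using R.hom_inverse[OF R.lap_factor_pos[of 0, where 'n = 'n]] by (simp add: R.pizzetti_coeff_def)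
  then have "of_nat (lap_factor TYPE('n) 0) * Const (?a 1) = (1 :: ('n, 'r) mpoly)"
    by (metis Const_1 Const_mult Const_of_nat mult.commute)
  ultimately have "?\<Delta> (Suc k) p = 0"
    by (metis mult.assoc mult_1)
  with least[of "Suc k"] show False by (simp add: Kk)
qed

end
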